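(* Let $d\in\{1,2,3,7,11\}$ and let $x=[0;a_1,\ldots,a_n]$ be a continued fraction expansion of $x$ with $a_\ell\in\mathbb{Z}[\omega_d]$ and $|a_\ell|\ge 4.17209$ for each $\ell\in\{1,\ldots,n\}$. Then $[0;a_1,\ldots,a_n]$ is the unique geodesic continued fraction expansion of $x$.
   Context: $\omega_d=\sqrt{-d}$ if $d\in\{1,2\}$ and $\omega_d=\frac{1+\sqrt{-d}}{2}$ if $d\in\{3,7,11\}$; $\mathbb{Z}[\omega_d]$ is the ring of integers of $\mathbb{Q}(\sqrt{-d})$. Notation: $[a_0;a_1,\ldots,a_n]=a_0+\cfrac{1}{a_1+\cfrac{1}{\ddots+\cfrac{1}{a_n}}}$; the $k$-th convergent is $\frac{p_k}{q_k}=[a_0;a_1,\ldots,a_k]$, $\frac{p_0}{q_0}=a_0$. The Farey graph $\mathcal{E}_d$ has vertex set $\mathbb{Q}(\sqrt{-d})\cup\{\infty\}$ and edges $A(\infty)\to A(0)$ for $A\in\mathrm{PSL}(2,\mathbb{Z}[\omega_d])$ acting by Möbius transformations (an undirected relation). A geodesic path is a walk of minimal length between its endpoints. A continued fraction expansion $[a_0;a_1,\ldots]$ with partial quotients in $\mathbb{Z}[\omega_d]$ is geodesic if $\infty\to\frac{p_0}{q_0}\to\cdots\to\frac{p_k}{q_k}$ is a geodesic path in $\mathcal{E}_d$ for every $k$. *)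

theory Defs
  imports
    "HOL-Analysis.Analysis"
    "Graph_Theory.Pair_Digraph"
    "Graph_Theory.Vertex_Walk"
begin

text \<open>
  The extended complex plane is \<^typ>\<open>complex option\<close>, with \<^const>\<open>None\<close> as the point at infinity and
  the one-point compactification \<^term>\<open>Alexandroff_compactification (euclidean :: complex topology)\<close>
  as its topology.
\<close>

definition omega :: "nat \<Rightarrow> complex" where
  "omega d = (if d \<in> {1, 2} then csqrt (- of_nat d) else (1 + csqrt (- of_nat d)) / 2)"

definition Z_omega :: "nat \<Rightarrow> complex set" where
  "Z_omega d = {of_int m + of_int n * omega d | m n. True}"

definition Q_sqrt :: "nat \<Rightarrow> complex set" where
  "Q_sqrt d = {of_rat r + of_rat s * csqrt (- of_nat d) | r s. True}"

definition ext_moebius :: "complex^2^2 \<Rightarrow> complex option \<Rightarrow> complex option" where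
  "ext_moebius A z =
     (case z of
        None \<Rightarrow> if A$2$1 = 0 then None else Some (A$1$1 / A$2$1)
      | Some w \<Rightarrow> if A$2$1 * w + A$2$2 = 0 then None
                  else Some (moebius (A$1$1) (A$1$2) (A$2$1) (A$2$2) w))"

definition SL2 :: "nat \<Rightarrow> (complex^2^2) set" where
  "SL2 d = {A. (\<forall>i j. A$i$j \<in> Z_omega d) \<and> det A = 1}"

text \<open>
  The group PSL(2) over the ring, realised as a group of transformations of the extended plane:
  two matrices in \<^term>\<open>SL2 d\<close> induce the same map iff they agree up to sign.
\<close>

definition PSL2 :: "nat \<Rightarrow> (complex option \<Rightarrow> complex option) set" where
  "PSL2 d = ext_moebius ` SL2 d"

text \<open>
  The arc relation is symmetric: precomposing with the map induced by the matrix with rows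
  \<open>(0, -1)\<close> and \<open>(1, 0)\<close> exchanges the two endpoints.
\<close>

definition farey_graph :: "nat \<Rightarrow> complex option pair_pre_digraph" where
  "farey_graph d =
     \<lparr> pverts = insert None (Some ` Q_sqrt d),
       parcs = {(f None, f (Some 0)) | f. f \<in> PSL2 d} \<rparr>"

definition geodesic_path :: "('a, 'b) pre_digraph \<Rightarrow> 'a list \<Rightarrow> bool" where
  "geodesic_path G p \<longleftrightarrow>
     vwalk p G \<and>
     (\<forall>q. vwalk q G \<and> hd q = hd p \<and> last q = last p \<longrightarrow> vwalk_length p \<le> vwalk_length q)"

definition ext_inverse :: "complex option \<Rightarrow> complex option" where
  "ext_inverse z = (case z of None \<Rightarrow> Some 0 | Some w \<Rightarrow> if w = 0 then None else Some (1 / w))"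

text \<open>
  The value of \<open>[a\<^sub>0; a\<^sub>1, \<dots>, a\<^sub>k]\<close>, computed in the extended plane since partial quotients are
  arbitrary elements of the ring. The empty expansion has value \<open>\<infinity>\<close>, so that \<open>[a\<^sub>0] = a\<^sub>0 + 1/\<infinity> = a\<^sub>0\<close>.
\<close>

primrec cf_value :: "complex list \<Rightarrow> complex option" where
  "cf_value [] = None"
| "cf_value (a # as) = map_option ((+) a) (ext_inverse (cf_value as))"

text \<open>
  \<open>Finite_CF a\<^sub>0 [a\<^sub>1, \<dots>, a\<^sub>n]\<close> is \<open>[a\<^sub>0; a\<^sub>1, \<dots>, a\<^sub>n]\<close> and \<open>Infinite_CF a\<close> is \<open>[a 0; a 1, a 2, \<dots>]\<close>.
\<close>

datatype cfrac = Finite_CF complex "complex list" | Infinite_CF "nat \<Rightarrow> complex"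

primrec cf_quotients :: "cfrac \<Rightarrow> complex set" where
  "cf_quotients (Finite_CF a as) = set (a # as)"
| "cf_quotients (Infinite_CF a) = range a"

definition cf_expansion_of :: "nat \<Rightarrow> cfrac \<Rightarrow> complex option \<Rightarrow> bool" where
  "cf_expansion_of d c x \<longleftrightarrow>
     cf_quotients c \<subseteq> Z_omega d \<and>
     (case c of
        Finite_CF a as \<Rightarrow> x = cf_value (a # as)
      | Infinite_CF a \<Rightarrow>
          limitin (Alexandroff_compactification euclidean)
            (\<lambda>k. cf_value (map a [0..<Suc k])) x sequentially)"

text \<open>
  The vertices \<open>\<infinity>, p\<^sub>0/q\<^sub>0, \<dots>, p\<^sub>k/q\<^sub>k\<close> for \<open>[a\<^sub>0; a\<^sub>1, \<dots>, a\<^sub>k]\<close>: the values of all prefixes, the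
  empty one giving \<open>\<infinity>\<close>.
\<close>

definition convergent_path :: "complex list \<Rightarrow> complex option list" where
  "convergent_path as = map (\<lambda>j. cf_value (take j as)) [0..<Suc (length as)]"

primrec geodesic_cf :: "nat \<Rightarrow> cfrac \<Rightarrow> bool" where
  "geodesic_cf d (Finite_CF a as) \<longleftrightarrow>
     (\<forall>k\<le>length as. geodesic_path (farey_graph d) (convergent_path (take (Suc k) (a # as))))"
| "geodesic_cf d (Infinite_CF a) \<longleftrightarrow>
     (\<forall>k. geodesic_path (farey_graph d) (convergent_path (map a [0..<Suc k])))"

definition geodesic_expansion_of :: "nat \<Rightarrow> cfrac \<Rightarrow> complex option \<Rightarrow> bool" where
  "geodesic_expansion_of d c x \<longleftrightarrow> cf_expansion_of d c x \<and> geodesic_cf d c"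

end

theory Submission
  imports Defs
begin

text \<open>
  Let \<open>x = [0; a\<^sub>1, \<dots>, a\<^sub>n]\<close> with all \<open>|a\<^sub>i| \<ge> 3\<close>. In the coordinates \<open>y\<^sub>0 = y\<close>, \<open>y\<^sub>i = 1/y\<^sub>i\<^sub>-\<^sub>1 - a\<^sub>i\<close>
  the \<open>i\<close>-th convergent is \<open>\<infinity>\<close>, and a path that avoids it must travel from the disc
  \<open>|y\<^sub>i + a\<^sub>i| \<le> 1\<close> to the disc \<open>|y\<^sub>i| \<le> 1\<close>, a gap of at least 1, by steps of length at most 1.
  This yields a function of the vertices that changes by at most 1 along each edge, equals \<open>n + 1\<close>
  at \<open>\<infinity>\<close> and 0 at \<open>x\<close>, and exceeds \<open>n\<close> at every neighbour of \<open>\<infinity>\<close> other than 0. So the distance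
  from \<open>\<infinity>\<close> to \<open>x\<close> is \<open>n + 1\<close>, a shortest path must start with \<open>\<infinity> \<rightarrow> 0\<close>, and the change of
  coordinates \<open>y \<mapsto> 1/y - a\<^sub>1\<close> gives uniqueness among paths by induction on \<open>n\<close>.

  Infinite expansions are excluded as follows. Moving \<open>x\<close> to \<open>\<infinity>\<close>, an infinite geodesic converging
  to \<open>x\<close> would converge to \<open>\<infinity>\<close>. By the Euclidean algorithm the distance from \<open>\<infinity>\<close> to \<open>p/q\<close> is
  \<open>O(log |q|)\<close>, so the denominators along a geodesic ray grow exponentially. As adjacent \<open>p/q\<close>
  and \<open>p'/q'\<close> are at Euclidean distance \<open>1/|q q'|\<close>, the ray stays bounded.
\<close>

section \<open>Walks and convergents over a discrete subring\<close>

lemma ext_inverse_simps [simp]: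
  "ext_inverse None = Some 0"
  "ext_inverse (Some 0) = None"
  "z \<noteq> 0 \<Longrightarrow> ext_inverse (Some z) = Some (1 / z)"
  by (auto simp: ext_inverse_def)

lemma ext_inverse_ext_inverse [simp]: "ext_inverse (ext_inverse y) = y"
  by (auto simp: ext_inverse_def split: option.split)

text \<open>Homogeneous coordinates: inversion swaps the entries and translation is linear.
  \<open>ext_frac 0 0\<close> is infinity by default, but a column of a matrix of determinant 1 is
  never zero.\<close>

definition ext_frac :: "complex \<Rightarrow> complex \<Rightarrow> complex option" where
  "ext_frac p q = (if q = 0 then None else Some (p / q))"

lemma ext_frac_minus [simp]: "ext_frac (- p) (- q) = ext_frac p q"
  by (simp add: ext_frac_def)

lemma ext_inverse_ext_frac: "p \<noteq> 0 \<or> q \<noteq> 0 \<Longrightarrow> ext_inverse (ext_frac p q) = ext_frac q p"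
  by (auto simp: ext_frac_def ext_inverse_def)

lemma translate_0 [simp]: "map_option ((+) (0::complex)) y = y"
  by (cases y) simp_all

lemma translate_ext_frac: "map_option ((+) a) (ext_frac p q) = ext_frac (p + a * q) q"
  by (auto simp: ext_frac_def field_simps)

text \<open>The coordinate change that sends the target \<open>[0; a, \<dots>]\<close> to the shorter target \<open>[0; \<dots>]\<close>.\<close>

definition cf_shift :: "complex \<Rightarrow> complex option \<Rightarrow> complex option" where
  "cf_shift a y = map_option ((+) (- a)) (ext_inverse y)"

definition cf_unshift :: "complex \<Rightarrow> complex option \<Rightarrow> complex option" where
  "cf_unshift a y = ext_inverse (map_option ((+) a) y)"

lemma cf_unshift_cf_shift [simp]: "cf_unshift a (cf_shift a y) = y"
  by (simp add: cf_unshift_def cf_shift_def option.map_comp comp_def option.map_ident)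

lemma cf_shift_cf_unshift [simp]: "cf_shift a (cf_unshift a y) = y"
  by (simp add: cf_unshift_def cf_shift_def option.map_comp comp_def option.map_ident)

lemma cf_shift_simps [simp]:
  "cf_shift a None = Some (- a)"
  "cf_shift a (Some 0) = None"
  "z \<noteq> 0 \<Longrightarrow> cf_shift a (Some z) = Some (1 / z - a)"
  by (simp_all add: cf_shift_def)

lemma cf_value_0_Cons: "cf_value (0 # a # l) = cf_unshift a (cf_value (0 # l))"
  by (simp add: cf_unshift_def)

lemma convergent_path_Nil [simp]: "convergent_path [] = [None]"
  by (simp add: convergent_path_def)

text \<open>Prepending a quotient moves all vertices of the old path by one Moebius map, so that
  induction on paths can run from the front.\<close>

lemma convergent_path_Cons:
  "convergent_path (a # l) =
     None # map (\<lambda>y. map_option ((+) a) (ext_inverse y)) (convergent_path l)"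
proof -
  have "[0..<Suc (length (a # l))] = 0 # map Suc [0..<Suc (length l)]"
    by (subst upt_conv_Cons) (simp_all add: map_Suc_upt del: upt_Suc)
  then show ?thesis
    by (simp add: convergent_path_def comp_def del: upt_Suc)
qed

lemma length_convergent_path [simp]: "length (convergent_path l) = Suc (length l)"
  by (simp add: convergent_path_def)

lemma convergent_path_neq_Nil [simp]: "convergent_path l \<noteq> []"
  by (simp add: convergent_path_def)

lemma hd_convergent_path [simp]: "hd (convergent_path l) = None"
  by (cases l) (simp_all add: convergent_path_Cons)

lemma last_convergent_path [simp]: "last (convergent_path l) = cf_value l"
  by (simp add: convergent_path_def)

lemma convergent_path_0_Cons:
  "convergent_path (0 # a # l) = None # map (cf_unshift a) (convergent_path (0 # l))"
  by (simp add: convergent_path_Cons cf_unshift_def comp_def)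

lemma inj_ext_inverse: "inj ext_inverse"
  by (metis injI ext_inverse_ext_inverse)

text \<open>The vertex after infinity is the first quotient, and y -> a + 1/y is injective. This
  turns uniqueness of walks into uniqueness of expansions.\<close>

lemma inj_convergent_path: "convergent_path l = convergent_path l' \<Longrightarrow> l = l'"
proof (induction l arbitrary: l')
  case Nil
  then show ?case
    by (cases l') (simp_all add: convergent_path_Cons)
next
  case (Cons a l)
  from Cons.prems have "length l' = Suc (length l)"
    by (metis length_Cons length_convergent_path nat.inject)
  then obtain b m where l': "l' = b # m"
    by (cases l') auto
  have eq: "map (\<lambda>y. map_option ((+) a) (ext_inverse y)) (convergent_path l) =
      map (\<lambda>y. map_option ((+) b) (ext_inverse y)) (convergent_path m)"
    using Cons.prems by (simp add: l' convergent_path_Cons)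
  have "hd (map (\<lambda>y. map_option ((+) a) (ext_inverse y)) (convergent_path l)) = Some a" for a l
    by (simp add: hd_map)
  with eq have ab: "a = b"
    by (metis option.inject)
  have "inj (\<lambda>y. map_option ((+) a) (ext_inverse y))"
    using inj_compose[OF option.inj_map inj_ext_inverse, of "(+) a"] by (simp add: comp_def)
  then have "convergent_path l = convergent_path m"
    using eq ab by (simp add: inj_map_eq_map)
  with Cons.IH ab l' show ?case
    by simp
qed

section \<open>Unimodular adjacency over a discrete subring\<close>

locale discrete_subring =
  fixes R :: "complex set"
  assumes zero_mem: "0 \<in> R"
    and one_mem: "1 \<in> R"
    and add_mem: "a \<in> R \<Longrightarrow> b \<in> R \<Longrightarrow> a + b \<in> R"
    and minus_mem: "a \<in> R \<Longrightarrow> - a \<in> R"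
    and mult_mem: "a \<in> R \<Longrightarrow> b \<in> R \<Longrightarrow> a * b \<in> R"
    and norm_ge_1: "a \<in> R \<Longrightarrow> a \<noteq> 0 \<Longrightarrow> 1 \<le> cmod a"
begin

text \<open>The two pairs are the columns of a matrix of determinant 1, that is, the images of
  infinity and 0 under its Moebius map.\<close>

definition adj :: "complex option \<Rightarrow> complex option \<Rightarrow> bool" where
  "adj u v \<longleftrightarrow> (\<exists>p q p' q'. {p, q, p', q'} \<subseteq> R \<and> p * q' - p' * q = 1 \<and>
     u = ext_frac p q \<and> v = ext_frac p' q')"

lemma adjI:
  assumes "p \<in> R" "q \<in> R" "p' \<in> R" "q' \<in> R" "p * q' - p' * q = 1"
  shows "adj (ext_frac p q) (ext_frac p' q')"
  using assms unfolding adj_def by blast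

lemma adjE:
  assumes "adj u v"
  obtains p q p' q' where "p \<in> R" "q \<in> R" "p' \<in> R" "q' \<in> R" "p * q' - p' * q = 1"
    "u = ext_frac p q" "v = ext_frac p' q'"
  using assms unfolding adj_def by auto

text \<open>Swapping the columns changes the sign of the determinant; negating one column restores
  it and keeps the fraction.\<close>

lemma adj_sym: "adj u v \<Longrightarrow> adj v u"
proof (elim adjE)
  fix p q p' q'
  assume *: "p \<in> R" "q \<in> R" "p' \<in> R" "q' \<in> R" "p * q' - p' * q = 1"
    and "u = ext_frac p q" "v = ext_frac p' q'"
  moreover have "adj (ext_frac p' q') (ext_frac (- p) (- q))"
    using * by (intro adjI) (auto intro: minus_mem simp: algebra_simps)
  ultimately show "adj v u"
    by simp
qed

lemma adj_ext_inverse: "adj u v \<Longrightarrow> adj (ext_inverse u) (ext_inverse v)"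
proof (elim adjE)
  fix p q p' q'
  assume *: "p \<in> R" "q \<in> R" "p' \<in> R" "q' \<in> R" "p * q' - p' * q = 1"
    and uv: "u = ext_frac p q" "v = ext_frac p' q'"
  have "p \<noteq> 0 \<or> q \<noteq> 0" "p' \<noteq> 0 \<or> q' \<noteq> 0"
    using *(5) by auto
  then have "ext_inverse u = ext_frac q p" "ext_inverse v = ext_frac (- q') (- p')"
    by (simp_all add: uv ext_inverse_ext_frac)
  moreover have "adj (ext_frac q p) (ext_frac (- q') (- p'))"
    using * by (intro adjI) (auto intro: minus_mem simp: algebra_simps)
  ultimately show ?thesis
    by simp
qed

lemma adj_translate:
  assumes "a \<in> R" "adj u v"
  shows "adj (map_option ((+) a) u) (map_option ((+) a) v)"
  using assms(2)
proof (elim adjE)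
  fix p q p' q'
  assume *: "p \<in> R" "q \<in> R" "p' \<in> R" "q' \<in> R" "p * q' - p' * q = 1"
    and uv: "u = ext_frac p q" "v = ext_frac p' q'"
  show ?thesis
    unfolding uv translate_ext_frac using assms(1) *
    by (intro adjI) (auto intro: add_mem mult_mem simp: algebra_simps)
qed

lemma adj_cf_shift: "a \<in> R \<Longrightarrow> adj u v \<Longrightarrow> adj (cf_shift a u) (cf_shift a v)"
  unfolding cf_shift_def by (intro adj_translate adj_ext_inverse minus_mem)

lemma adj_cf_unshift: "a \<in> R \<Longrightarrow> adj u v \<Longrightarrow> adj (cf_unshift a u) (cf_unshift a v)"
  unfolding cf_unshift_def by (intro adj_translate adj_ext_inverse)

lemma adj_None_Some: "a \<in> R \<Longrightarrow> adj None (Some a)"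
  using adjI[of 1 0 a 1] by (simp add: ext_frac_def zero_mem one_mem)

lemma adj_NoneD: "adj None v \<Longrightarrow> \<exists>a\<in>R. v = Some a"
proof (elim adjE)
  fix p q p' q'
  assume *: "p \<in> R" "q \<in> R" "p' \<in> R" "q' \<in> R" "p * q' - p' * q = 1"
    and uv: "None = ext_frac p q" "v = ext_frac p' q'"
  have q: "q = 0"
    using uv(1) by (simp add: ext_frac_def split: if_splits)
  \<comment> \<open>So \<open>p\<close> inverts \<open>q'\<close>, and p'/q' = p' p lies in the
    ring.\<close>
  then have "p * q' = 1"
    using * by simp
  then have "v = Some (p' * p)"
    using uv by (auto simp: ext_frac_def field_simps)
  then show ?thesis
    using * mult_mem by blast
qed

text \<open>The difference is 1/(q q') with both denominators of modulus at least 1. If v is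
  nonzero, its numerator also has modulus at least 1, hence 1/|q q'| <= |p'/q'|.\<close>

lemma adj_Some_dist:
  assumes "adj (Some u) (Some v)"
  shows "cmod (u - v) \<le> 1" and "v \<noteq> 0 \<Longrightarrow> cmod (u - v) \<le> cmod v"
proof -
  obtain p q p' q' where *: "p \<in> R" "q \<in> R" "p' \<in> R" "q' \<in> R" "p * q' - p' * q = 1"
    and uv: "Some u = ext_frac p q" "Some v = ext_frac p' q'"
    using assms by (elim adjE)
  have q: "q \<noteq> 0" "q' \<noteq> 0" and uv': "u = p / q" "v = p' / q'"
    using uv by (auto simp: ext_frac_def split: if_splits)
  have "u - v = 1 / (q * q')"
    using * q by (simp add: uv' field_simps)
  then have d: "cmod (u - v) = 1 / (cmod q * cmod q')"
    by (simp add: norm_divide norm_mult)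
  have n: "1 \<le> cmod q" "1 \<le> cmod q'"
    using norm_ge_1 * q by auto
  then have "1 * 1 \<le> cmod q * cmod q'"
    by (intro mult_mono) auto
  then show "cmod (u - v) \<le> 1"
    by (simp add: d divide_le_eq)
  assume "v \<noteq> 0"
  then have "1 \<le> cmod p'"
    using norm_ge_1 * q uv' by auto
  then have "1 * 1 \<le> cmod q * cmod p'"
    using n by (intro mult_mono) auto
  then have "1 / (cmod q * cmod q') \<le> cmod v"
    using n q divide_right_mono[of 1 "cmod q * cmod p'" "cmod q * cmod q'"]
    by (simp add: uv' norm_divide)
  then show "cmod (u - v) \<le> cmod v"
    by (simp add: d)
qed

lemma successively_adj_map:
  assumes "\<And>u v. adj u v \<Longrightarrow> adj (f u) (f v)" "successively adj p"
  shows "successively adj (map f p)"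
  unfolding successively_map using assms(2) by (rule successively_mono) (use assms(1) in auto)

lemma successively_adj_convergent_path:
  "set l \<subseteq> R \<Longrightarrow> successively adj (convergent_path l)"
proof (induction l)
  case Nil
  then show ?case
    by simp
next
  case (Cons a l)
  then have "successively adj (map (\<lambda>y. map_option ((+) a) (ext_inverse y)) (convergent_path l))"
    by (intro successively_adj_map adj_translate adj_ext_inverse) auto
  then show ?case
    using Cons.prems by (simp add: convergent_path_Cons successively_Cons hd_map adj_None_Some)
qed

section \<open>A Lipschitz lower bound for the distance to a continued fraction\<close>

text \<open>A clipped modulus, rising from 1/2 on the unit disc to 3/2 outside radius 2. Infinity
  gets the midpoint 1, within 1/2 of every other value.\<close>

definition height :: "complex option \<Rightarrow> real" where
  "height y = (case y of None \<Rightarrow> 1 | Some z \<Rightarrow> min (3/2) (max (1/2) (cmod z - 1/2)))"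

text \<open>
  On the circle \<open>|y| = 1\<close> both branches agree: there \<open>|1/y - a| \<ge> 2\<close>, so that the height drops from
  its maximum 3/2 in the new coordinate to its minimum 1/2 in the old one while \<open>n\<close> grows by 1.
\<close>

fun potential :: "complex list \<Rightarrow> complex option \<Rightarrow> real" where
  "potential [] y = (if y = Some 0 then 0 else height y)"
| "potential (a # as) y =
     (if \<exists>z. y = Some z \<and> cmod z < 1 then potential as (cf_shift a y)
      else real (length as) + 1 + height y)"

lemma height_bounds: "1/2 \<le> height y" "height y \<le> 3/2"
  by (auto simp: height_def min_def max_def split: option.split)

lemma potential_far:
  "\<nexists>z. y = Some z \<and> cmod z < 1 \<Longrightarrow> potential as y = real (length as) + height y"
  by (cases as) auto

lemma potential_None [simp]: "potential as None = real (length as) + 1"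
  by (simp add: potential_far height_def)

lemma potential_0: "potential as (Some 0) = real (length as)"
  by (cases as) simp_all

text \<open>The bound 1/2 reproduces itself: |a + z| >= 3 - 1/2 > 2. The target thus stays in the
  open unit disc, where \<open>potential\<close> recurses down to the value 0.\<close>

lemma potential_cf_value_bounded:
  assumes "\<forall>a\<in>set as. 3 \<le> cmod a"
  shows "\<exists>z. cf_value (0 # as) = Some z \<and> cmod z \<le> 1/2 \<and> potential as (Some z) = 0
     \<and> (as \<noteq> [] \<longrightarrow> z \<noteq> 0)"
  using assms
proof (induction as)
  case Nil
  then show ?case
    by simp
next
  case (Cons a as)
  then obtain z where z: "cf_value (0 # as) = Some z" "cmod z \<le> 1/2" "potential as (Some z) = 0"
    by auto
  have "cmod a \<le> cmod (a + z) + cmod z"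
    by (metis add_diff_cancel_right' norm_triangle_ineq4)
  then have az: "2 \<le> cmod (a + z)"
    using Cons.prems z(2) by simp
  then have nz: "a + z \<noteq> 0"
    by auto
  have le: "cmod (1 / (a + z)) \<le> 1/2"
    using az nz by (simp add: norm_divide divide_le_eq)
  have "cf_value (0 # a # as) = Some (1 / (a + z))"
    using z(1) nz by (simp only: cf_value_0_Cons) (simp add: cf_unshift_def)
  moreover have "potential (a # as) (Some (1 / (a + z))) = 0"
    using le nz z(3) by simp
  ultimately show ?case
    using le nz by simp
qed

text \<open>The critical edges are those crossing the unit circle, since the two endpoints are then
  measured in different coordinates.\<close>

lemma potential_crossing:
  assumes a: "3 \<le> cmod a" and "adj (Some u) (Some v)" "1 \<le> cmod u" "cmod v < 1"
  shows "\<bar>potential (a # as) (Some u) - potential (a # as) (Some v)\<bar> \<le> 1"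
proof (cases "v = 0")
  case True
  then have "cmod u \<le> 1"
    using adj_Some_dist(1)[OF assms(2)] by simp
  then have "height (Some u) = 1/2"
    using assms(3) by (simp add: height_def)
  then show ?thesis
    using True assms(3) potential_0[of "a # as"] potential_far[of "Some u" "a # as"] by simp
next
  case False
  have "cmod u - cmod v \<le> cmod v"
    using adj_Some_dist(2)[OF assms(2) False] norm_triangle_ineq2[of u v] by linarith
  then have uv: "cmod u \<le> 2 * cmod v"
    by simp
  define r where "r = cmod u"
  define t where "t = 1 / cmod v"
  have v: "cmod v = 1 / t" and t: "1 < t"
    using False assms(4) by (auto simp: t_def)
  have rt: "r * t \<le> 2" "1 \<le> r"
    using uv t v assms(3) by (simp_all add: r_def v field_simps)
  \<comment> \<open>Expanded with \<open>r * t\<close> at most 2, this gives \<open>r + t\<close> at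
    most 3. As t = |1/v|, the new coordinate \<open>z\<close> of v satisfies |z| >= 3 - t >= r, so
    its height is at least that of u.\<close>
  have "0 \<le> (r - 1) * (t - 1)"
    using rt t by simp
  then have sum: "r + t \<le> 3"
    using rt by (simp add: algebra_simps)
  define z where "z = 1 / v - a"
  have "cmod a - t \<le> cmod z"
    using norm_triangle_ineq2[of a "1 / v"]
    by (simp add: z_def t_def norm_divide norm_minus_commute)
  then have z: "3 - t \<le> cmod z"
    using a by simp
  then have z1: "1 \<le> cmod z"
    using rt(2) sum by simp
  have pv: "potential (a # as) (Some v) = real (length as) + height (Some z)"
    using False assms(4) z1 potential_far[of "Some z" as] by (simp add: z_def)
  have pu: "potential (a # as) (Some u) = real (length as) + 1 + height (Some u)"
    using assms(3) by simp
  have "height (Some u) \<le> r - 1/2" "1/2 \<le> height (Some u)"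
    using rt(2) by (auto simp: height_def r_def)
  moreover have "5/2 - t \<le> height (Some z)"
    using z t by (auto simp: height_def)
  moreover have "height (Some z) \<le> 3/2"
    by (rule height_bounds)
  ultimately show ?thesis
    using sum unfolding pu pv by linarith
qed

text \<open>Inside the unit disc, change coordinates and induct; outside, heights differ by at most
  1. For a mixed edge at infinity, the other end is a ring element in the open disc, hence
  0.\<close>

lemma potential_Lipschitz:
  assumes "set as \<subseteq> R" "\<forall>a\<in>set as. 3 \<le> cmod a" "adj u v"
  shows "\<bar>potential as u - potential as v\<bar> \<le> 1"
  using assms
proof (induction as arbitrary: u v)
  case Nil
  have *: "\<bar>potential [] (Some x) - potential [] None\<bar> \<le> 1" for x
    using height_bounds[of "Some x"] by auto
  have **: "\<bar>height (Some x) - height (Some y)\<bar> \<le> 1" for x y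
    using height_bounds[of "Some x"] height_bounds[of "Some y"] by auto
  \<comment> \<open>The target 0 has potential 0, below the range of heights, so its neighbours need
    this separate bound.\<close>
  have ***: "height (Some x) \<le> 1" if "adj (Some x) (Some 0)" for x
    using adj_Some_dist(1)[OF that] by (simp add: height_def)
  show ?case
  proof (cases u; cases v)
    fix x y assume "u = Some x" "v = Some y"
    then show ?thesis
      using ***[of x] ***[of y] **[of x y] Nil.prems(3) adj_sym[OF Nil.prems(3)]
        height_bounds(1)[of u] height_bounds(1)[of v] by auto
  qed (use * in \<open>auto simp: abs_minus_commute\<close>)
next
  case (Cons a as)
  let ?near = "\<lambda>y. \<exists>z. y = Some z \<and> cmod z < 1"
  have far_near: "\<bar>potential (a # as) u - potential (a # as) v\<bar> \<le> 1"
    if "adj u v" "\<not> ?near u" "?near v" for u v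
  proof (cases u)
    case None
    then obtain b where b: "b \<in> R" "v = Some b"
      using \<open>adj u v\<close> adj_NoneD by blast
    with that(3) norm_ge_1[of b] have "b = 0"
      by fastforce
    then show ?thesis
      using b None potential_0[of "a # as"] by simp
  next
    case (Some x)
    then show ?thesis
      using that potential_crossing[of a x] Cons.prems(2) by (auto simp del: potential.simps)
  qed
  consider "?near u" "?near v" | "\<not> ?near u" "?near v" | "?near u" "\<not> ?near v"
    | "\<not> ?near u" "\<not> ?near v"
    by blast
  then show ?case
  proof cases
    case 1
    then have "potential (a # as) u = potential as (cf_shift a u)"
      "potential (a # as) v = potential as (cf_shift a v)"
      by simp_all
    with Cons show ?thesis
      by (simp add: adj_cf_shift)
  next
    case 2
    then show ?thesis
      using far_near Cons.prems by blast
  next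
    case 3
    then show ?thesis
      using far_near[of v u] adj_sym Cons.prems by (metis abs_minus_commute)
  next
    case 4
    then show ?thesis
      using height_bounds[of u] height_bounds[of v] by (auto simp: abs_le_iff)
  qed
qed

lemma potential_walk:
  assumes "set as \<subseteq> R" "\<forall>a\<in>set as. 3 \<le> cmod a" "successively adj p" "p \<noteq> []"
  shows "potential as (hd p) - potential as (last p) \<le> real (length p) - 1"
  using assms(3,4)
proof (induction p)
  case (Cons u p)
  show ?case
  proof (cases "p = []")
    case False
    then have "adj u (hd p)" "successively adj p"
      using Cons.prems by (auto simp: successively_Cons)
    then show ?thesis
      using Cons.IH False potential_Lipschitz[OF assms(1,2), of u "hd p"] by simp
  qed simp
qed simp

text \<open>The potential forces the first step to go to 0; a coordinate change then shortens the
  target. Lengths count vertices, so the bound means one edge more than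
  \<open>length as\<close>.\<close>

lemma short_walk_eq_convergent_path:
  assumes "set as \<subseteq> R" "\<forall>a\<in>set as. 3 \<le> cmod a"
    and "successively adj p" "p \<noteq> []" "hd p = None" "last p = cf_value (0 # as)"
    and "length p \<le> length as + 2"
  shows "p = convergent_path (0 # as)"
  using assms
proof (induction as arbitrary: p)
  case Nil
  then obtain p' where p: "p = None # p'"
    by (cases p) auto
  with Nil have "p' \<noteq> []" "length p' \<le> 1" "last p' = Some 0"
    by (auto split: if_splits)
  then have "p' = [Some 0]"
    by (cases p') auto
  then show ?case
    by (simp add: p convergent_path_Cons)
next
  case (Cons a as)
  obtain z where z: "cf_value (0 # a # as) = Some z" "potential (a # as) (Some z) = 0"
    using potential_cf_value_bounded[OF Cons.prems(2)] by blast
  from Cons.prems(4,5) obtain p' where p: "p = None # p'"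
    by (cases p) auto
  with Cons.prems(6) z(1) have p': "p' \<noteq> []" "last p' = cf_value (0 # a # as)"
    by (auto split: if_splits)
  with Cons.prems(3) have adj: "adj None (hd p')" and succ: "successively adj p'"
    by (auto simp: p successively_Cons)
  then obtain b where b: "b \<in> R" "hd p' = Some b"
    using adj_NoneD by blast
  \<comment> \<open>At most \<open>length as + 1\<close> edges remain, while outside the open unit
    disc the potential is at least \<open>length as + 3/2\<close>. The only ring element in the disc
    is 0.\<close>
  have "potential (a # as) (hd p') \<le> real (length p') - 1"
    using potential_walk[OF Cons.prems(1,2) succ p'(1)] z p'(2) by (simp del: potential.simps)
  also have "\<dots> \<le> real (length as) + 1"
    using Cons.prems(7) p by simp
  finally have "\<not> 1 \<le> cmod b"
    using b(2) height_bounds(1)[of "Some b"] potential_far[of "Some b" "a # as"] by auto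
  then have hd: "hd p' = Some 0"
    using b norm_ge_1 by blast
  \<comment> \<open>The shift sends 0 to infinity, so the rest of the walk again starts at
    infinity.\<close>
  let ?p = "map (cf_shift a) p'"
  have "last ?p = cf_value (0 # as)"
    using p' by (simp add: last_map cf_value_0_Cons del: cf_value.simps)
  moreover have "successively adj ?p"
    using succ Cons.prems(1) by (intro successively_adj_map adj_cf_shift) auto
  ultimately have "?p = convergent_path (0 # as)"
    using Cons.prems p' hd p by (intro Cons.IH) (auto simp: hd_map)
  then have "map (cf_unshift a) ?p = map (cf_unshift a) (convergent_path (0 # as))"
    by simp
  then have "p' = map (cf_unshift a) (convergent_path (0 # as))"
    by (simp add: comp_def)
  then show ?case
    by (simp add: p convergent_path_0_Cons)
qed

text \<open>A walk with at most this many vertices is the convergent path, which has exactly this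
  many.\<close>

lemma walk_length_ge:
  assumes "set as \<subseteq> R" "\<forall>a\<in>set as. 3 \<le> cmod a"
    and "successively adj p" "p \<noteq> []" "hd p = None" "last p = cf_value (0 # as)"
  shows "length as + 2 \<le> length p"
  using short_walk_eq_convergent_path[OF assms] by (cases "length p \<le> length as + 2") auto

end

section \<open>Geodesic rays do not converge to vertices\<close>

text \<open>The start is arbitrary because coordinate changes move it. Since \<open>length\<close>
  counts vertices, \<open>k < length p\<close> says that \<open>p\<close> has at least k
  edges.\<close>

definition (in discrete_subring) geodesic_ray :: "(nat \<Rightarrow> complex option) \<Rightarrow> bool" where
  "geodesic_ray w \<longleftrightarrow> (\<forall>k. adj (w k) (w (Suc k))) \<and>
     (\<forall>k p. p \<noteq> [] \<and> successively adj p \<and> hd p = w 0 \<and> last p = w k \<longrightarrow> k < length p)"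

lemma (in discrete_subring) geodesic_ray_image:
  assumes "geodesic_ray w"
    and f: "\<And>u v. adj u v \<Longrightarrow> adj (f u) (f v)"
    and g: "\<And>u v. adj u v \<Longrightarrow> adj (g u) (g v)" "\<And>u. g (f u) = u"
  shows "geodesic_ray (\<lambda>k. f (w k))"
  unfolding geodesic_ray_def
proof (intro conjI allI impI)
  show "adj (f (w k)) (f (w (Suc k)))" for k
    using assms(1) f by (auto simp: geodesic_ray_def)
next
  fix k p
  assume p: "p \<noteq> [] \<and> successively adj p \<and> hd p = f (w 0) \<and> last p = f (w k)"
  then have "successively adj (map g p)"
    by (intro successively_adj_map g(1)) auto
  then have "k < length (map g p)"
    using assms(1) p unfolding geodesic_ray_def
    by (metis g(2) hd_map last_map map_is_Nil_conv)
  then show "k < length p"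
    by simp
qed

locale euclidean_discrete_subring = discrete_subring +
  fixes \<rho> :: real
  assumes rho_pos: "0 < \<rho>" and rho_less_1: "\<rho> < 1"
    and round_mem: "\<exists>b\<in>R. cmod (z - b) \<le> \<rho>"
begin

text \<open>Euclidean algorithm: each division shrinks the denominator by the factor \<rho>, and a
  denominator of modulus below 1 is 0.\<close>

lemma ext_frac_short_expansion:
  assumes "p \<in> R" "q \<in> R" "cmod q * \<rho> ^ m < 1"
  shows "\<exists>l. set l \<subseteq> R \<and> length l \<le> m \<and> cf_value l = ext_frac p q"
  using assms
proof (induction m arbitrary: p q)
  case 0
  then have "q = 0"
    using norm_ge_1 by fastforce
  then show ?case
    by (intro exI[of _ "[]"]) (simp add: ext_frac_def)
next
  case (Suc m)
  show ?case
  proof (cases "q = 0")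
    case True
    then show ?thesis
      by (intro exI[of _ "[]"]) (simp add: ext_frac_def)
  next
    case False
    obtain b where b: "b \<in> R" "cmod (p / q - b) \<le> \<rho>"
      using round_mem by blast
    define r where "r = p + - b * q"
    have r: "r \<in> R"
      unfolding r_def using Suc.prems b by (intro add_mem mult_mem minus_mem)
    have "r = (p / q - b) * q"
      using False by (simp add: r_def field_simps)
    then have "cmod r \<le> \<rho> * cmod q"
      using b(2) by (simp add: norm_mult mult_right_mono)
    then have "cmod r * \<rho> ^ m \<le> \<rho> * cmod q * \<rho> ^ m"
      using rho_pos by (intro mult_right_mono) auto
    also have "\<dots> < 1"
      using Suc.prems(3) by (simp add: mult_ac)
    finally obtain l where l: "set l \<subseteq> R" "length l \<le> m" "cf_value l = ext_frac q r"
      using Suc.IH[OF Suc.prems(2) r] by blast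
    have "cf_value (b # l) = ext_frac p q"
      using False by (simp add: l(3) ext_inverse_ext_frac translate_ext_frac) (simp add: r_def)
    then show ?thesis
      using l b by (intro exI[of _ "b # l"]) auto
  qed
qed

lemma geodesic_ray_eventually_bounded:
  assumes "geodesic_ray w"
  shows "\<exists>B N. \<forall>k\<ge>N. \<exists>z. w k = Some z \<and> cmod z \<le> B"
proof -
  have adj: "adj (w k) (w (Suc k))" for k
    using assms by (simp add: geodesic_ray_def)
  obtain p q where pq: "p \<in> R" "q \<in> R" "w 0 = ext_frac p q"
    using adj[of 0] by (elim adjE)
  have "(\<lambda>m. cmod q * \<rho> ^ m) \<longlonglongrightarrow> cmod q * 0"
    using rho_pos rho_less_1 by (intro tendsto_intros LIMSEQ_realpow_zero) auto
  then have "\<forall>\<^sub>F m in sequentially. cmod q * \<rho> ^ m < 1"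
    by (rule order_tendstoD) simp
  then obtain m0 where "cmod q * \<rho> ^ m0 < 1"
    by (auto simp: eventually_sequentially)
  then obtain l0 where l0: "set l0 \<subseteq> R" "cf_value l0 = w 0"
    using ext_frac_short_expansion pq by metis
  \<comment> \<open>This offset pays for the detour from \<open>w 0\<close> to infinity, with one
    extra to contradict minimality strictly.\<close>
  define N where "N = Suc (length l0)"
  have denominator: "1 \<le> cmod q * \<rho> ^ k"
    if pq: "p \<in> R" "q \<in> R" "w (N + k) = ext_frac p q" for p q k
  proof (rule ccontr)
    assume "\<not> ?thesis"
    then have "cmod q * \<rho> ^ k < 1"
      by simp
    then obtain l where l: "set l \<subseteq> R" "length l \<le> k" "cf_value l = w (N + k)"
      using ext_frac_short_expansion[OF pq(1,2)] unfolding pq(3) by blast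
    \<comment> \<open>From \<open>w 0\<close> back to infinity and on to \<open>w (N + k)\<close>;
      \<open>tl\<close> removes the repeated infinity. It has at most \<open>N + k\<close>
      vertices.\<close>
    define p' where "p' = rev (convergent_path l0) @ tl (convergent_path l)"
    have sl: "successively adj (convergent_path l)"
      using l successively_adj_convergent_path by simp
    have sl0: "successively adj (rev (convergent_path l0))"
      using successively_adj_convergent_path[OF l0(1)]
      by (auto intro: successively_mono adj_sym)
    obtain t where t: "convergent_path l = None # t"
      by (metis convergent_path_neq_Nil hd_convergent_path list.exhaust_sel)
    have "successively adj p'"
      using sl sl0 by (auto simp: p'_def t successively_append_iff successively_Cons last_rev)
    moreover have "hd p' = w 0"
      using l0 by (simp add: p'_def hd_append hd_rev)
    moreover have "last p' = w (N + k)"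
      using l(3) last_convergent_path[of l] by (auto simp: p'_def t last_append last_rev)
    ultimately have "N + k < length p'"
      using assms unfolding geodesic_ray_def by (metis p'_def append_is_Nil_conv
          convergent_path_neq_Nil rev_is_Nil_conv)
    then show False
      using l(2) by (simp add: p'_def N_def)
  qed
  \<comment> \<open>A zero denominator would violate \<open>denominator\<close>, so the ray has left
    infinity for good.\<close>
  have "\<forall>k. \<exists>z. w (N + k) = Some z"
  proof
    fix k
    obtain p q where "p \<in> R" "q \<in> R" "w (N + k) = ext_frac p q"
      using adj[of "N + k"] by (elim adjE)
    then show "\<exists>z. w (N + k) = Some z"
      using denominator[of p q k] by (auto simp: ext_frac_def)
  qed
  then obtain z where z: "\<And>k. w (N + k) = Some (z k)"
    by metis
  have step: "cmod (z (Suc k) - z k) \<le> \<rho> ^ k" for k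
  proof -
    obtain p q p' q' where *: "p \<in> R" "q \<in> R" "p' \<in> R" "q' \<in> R" "p * q' - p' * q = 1"
      and w: "w (N + k) = ext_frac p q" "w (N + Suc k) = ext_frac p' q'"
      using adj[of "N + k"] by (auto elim: adjE)
    have q: "q \<noteq> 0" "q' \<noteq> 0" and zz: "z k = p / q" "z (Suc k) = p' / q'"
      using z[of k] z[of "Suc k"] w by (auto simp: ext_frac_def split: if_splits)
    have "z (Suc k) - z k = - (1 / (q * q'))"
      using * q by (simp add: zz field_simps)
    then have "cmod (z (Suc k) - z k) = 1 / (cmod q * cmod q')"
      by (simp add: norm_divide norm_mult)
    also have "\<dots> \<le> 1 / cmod q"
    proof -
      have "cmod q * 1 \<le> cmod q * cmod q'"
        using norm_ge_1 * q by (intro mult_left_mono) auto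
      then show ?thesis
        using q by (intro divide_left_mono) auto
    qed
    also have "\<dots> \<le> \<rho> ^ k"
      using denominator[OF *(1,2) w(1)] q by (simp add: divide_le_eq mult.commute)
    finally show ?thesis .
  qed
  have "cmod (z k) \<le> cmod (z 0) + (\<Sum>i<k. \<rho> ^ i)" for k
  proof (induction k)
    case (Suc k)
    then show ?case
      using step[of k] norm_triangle_sub[of "z (Suc k)" "z k"] by simp
  qed simp
  moreover have "(\<Sum>i<k. \<rho> ^ i) \<le> (\<Sum>i. \<rho> ^ i)" for k
    using rho_pos rho_less_1 by (intro sum_le_suminf summable_geometric) auto
  ultimately have "cmod (z k) \<le> cmod (z 0) + (\<Sum>i. \<rho> ^ i)" for k
    by (meson add_left_mono order_trans)
  then show ?thesis
    using z by (metis le_Suc_ex)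
qed

text \<open>Coordinate changes reduce the limit to 0, and inversion then sends it to infinity,
  against boundedness. Eventual finiteness is assumed because \<open>the None\<close> is
  unspecified.\<close>

lemma geodesic_ray_not_tendsto_convergent:
  assumes "set as \<subseteq> R" "\<forall>a\<in>set as. 3 \<le> cmod a"
    and "geodesic_ray w" "cf_value (0 # as) = Some \<xi>"
    and "\<forall>\<^sub>F k in sequentially. w k \<noteq> None"
  shows "\<not> (\<lambda>k. the (w k)) \<longlonglongrightarrow> \<xi>"
  using assms
proof (induction as arbitrary: w \<xi>)
  case Nil
  have \<xi>: "\<xi> = 0"
    using Nil by simp
  have "geodesic_ray (\<lambda>k. ext_inverse (w k))"
    using Nil by (intro geodesic_ray_image[where f = ext_inverse and g = ext_inverse] adj_ext_inverse) auto
  then obtain B N where B: "\<And>k. N \<le> k \<Longrightarrow> \<exists>z. ext_inverse (w k) = Some z \<and> cmod z \<le> B"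
    using geodesic_ray_eventually_bounded by blast
  show ?case
  proof
    assume "(\<lambda>k. the (w k)) \<longlonglongrightarrow> \<xi>"
    then have "\<forall>\<^sub>F k in sequentially. cmod (the (w k)) < 1 / (\<bar>B\<bar> + 1)"
      \<comment> \<open>Below this threshold the inverse exceeds B in modulus; \<bar>B\<bar> keeps
        the threshold positive before the sign of B is known.\<close>
      unfolding \<xi> by (intro order_tendstoD[OF tendsto_norm_zero]) auto
    then have ev: "\<forall>\<^sub>F k in sequentially.
        cmod (the (w k)) < 1 / (\<bar>B\<bar> + 1) \<and> w k \<noteq> None \<and> N \<le> k"
      using Nil.prems(5) eventually_ge_at_top[of N] by eventually_elim auto
    obtain k where k: "cmod (the (w k)) < 1 / (\<bar>B\<bar> + 1)" "w k \<noteq> None" "N \<le> k"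
      using eventually_happens'[OF sequentially_bot ev] by blast
    then obtain y where y: "w k = Some y"
      by blast
    with B[OF k(3)] have "y \<noteq> 0" "1 / cmod y \<le> B"
      by (auto simp: ext_inverse_def norm_divide split: if_splits)
    moreover from this have "0 < cmod y" "0 < B"
      by (auto intro: less_le_trans[of _ "1 / cmod y"])
    ultimately have "1 \<le> B * cmod y" "cmod y + B * cmod y < 1" "0 < cmod y"
      using k(1) y by (simp_all add: field_simps)
    then show False
      by linarith
  qed
next
  case (Cons a as)
  obtain \<zeta> where \<zeta>: "cf_value (0 # as) = Some \<zeta>"
    using potential_cf_value_bounded[of as] Cons.prems(2) by auto
  have \<xi>: "\<xi> \<noteq> 0"
    using potential_cf_value_bounded[OF Cons.prems(2)] Cons.prems(4) by auto
  have "cf_shift a (Some \<xi>) = Some \<zeta>"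
    using Cons.prems(4) \<zeta> by (metis cf_value_0_Cons cf_shift_cf_unshift)
  then have \<zeta>_eq: "\<zeta> = 1 / \<xi> - a"
    using \<xi> by simp
  show ?case
  proof
    assume lim: "(\<lambda>k. the (w k)) \<longlonglongrightarrow> \<xi>"
    \<comment> \<open>Away from 0 the shift is continuous and takes finite values, so convergence
      and eventual finiteness carry over.\<close>
    have "\<forall>\<^sub>F k in sequentially. the (w k) \<noteq> 0"
      using tendsto_imp_eventually_ne[OF lim \<xi>] .
    then have ev: "\<forall>\<^sub>F k in sequentially. cf_shift a (w k) = Some (1 / the (w k) - a)"
      using Cons.prems(5) by eventually_elim auto
    have "(\<lambda>k. 1 / the (w k) - a) \<longlonglongrightarrow> \<zeta>"
      unfolding \<zeta>_eq using lim \<xi> by (intro tendsto_intros)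
    then have "(\<lambda>k. the (cf_shift a (w k))) \<longlonglongrightarrow> \<zeta>"
      by (rule Lim_transform_eventually) (use ev in eventually_elim, simp)
    moreover have "geodesic_ray (\<lambda>k. cf_shift a (w k))"
      using Cons.prems
      by (intro geodesic_ray_image[where f = "cf_shift a" and g = "cf_unshift a"]
          adj_cf_shift adj_cf_unshift) auto
    moreover have "\<forall>\<^sub>F k in sequentially. cf_shift a (w k) \<noteq> None"
      using ev by eventually_elim simp
    ultimately show False
      using Cons.IH[OF _ _ _ \<zeta>] Cons.prems by auto
  qed
qed

end

section \<open>The rings of integers\<close>

lemma csqrt_minus_of_nat: "csqrt (- of_nat d) = \<i> * sqrt d"
  using csqrt_of_real_nonpos[of "- real d"] by simp

lemma Re_omega: "Re (omega d) = (if d \<in> {1, 2} then 0 else 1/2)"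
  and Im_omega: "Im (omega d) = (if d \<in> {1, 2} then sqrt d else sqrt d / 2)"
  by (simp_all add: omega_def csqrt_minus_of_nat del: csqrt_minus)

lemma omega_square:
  assumes "d \<in> {1, 2, 3, 7, 11}"
  shows "\<exists>s t :: int. omega d * omega d = of_int s + of_int t * omega d"
proof (cases "d \<in> {1, 2}")
  case True
  then have "omega d * omega d = of_int (- int d) + of_int 0 * omega d"
    by (auto simp: complex_eq_iff Re_omega Im_omega)
  then show ?thesis
    by blast
next
  case False
  \<comment> \<open>\<open>e\<close> is (d + 1)/4, the norm of \<open>omega d\<close>.\<close>
  define e where "e = (if d = 3 then 1 else if d = 7 then 2 else 3 :: int)"
  have "real d = 4 * real_of_int e - 1"
    using False assms by (auto simp: e_def)
  then have "omega d * omega d = of_int (- e) + of_int 1 * omega d"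
    using False by (auto simp: complex_eq_iff Re_omega Im_omega field_simps)
  then show ?thesis
    by blast
qed

text \<open>The squared modulus is an integral quadratic form in the coordinates, hence a positive
  integer.\<close>

lemma Z_omega_norm_ge_1:
  assumes "d \<in> {1, 2, 3, 7, 11}" "a \<in> Z_omega d" "a \<noteq> 0"
  shows "1 \<le> cmod a"
proof -
  obtain m n :: int where a: "a = of_int m + of_int n * omega d"
    using assms(2) by (auto simp: Z_omega_def)
  have "\<exists>k :: int. (cmod a)\<^sup>2 = of_int k"
  proof (cases "d \<in> {1, 2}")
    case True
    then have "(cmod a)\<^sup>2 = of_int (m\<^sup>2 + int d * n\<^sup>2)"
      by (auto simp: cmod_power2 a Re_omega Im_omega power_mult_distrib)
    then show ?thesis
      by blast
  next
    case False
    define e where "e = (if d = 3 then 1 else if d = 7 then 2 else 3 :: int)"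
    have "real d = 4 * real_of_int e - 1"
      using False assms by (auto simp: e_def)
    then have "(cmod a)\<^sup>2 = of_int (m\<^sup>2 + m * n + e * n\<^sup>2)"
      using False
      by (simp add: cmod_power2 a Re_omega Im_omega power_mult_distrib power_divide)
        (simp add: power2_eq_square field_simps)
    then show ?thesis
      by blast
  qed
  then obtain k :: int where k: "(cmod a)\<^sup>2 = of_int k"
    by blast
  have "0 < (cmod a)\<^sup>2"
    using assms(3) by simp
  then have "1 \<le> (cmod a)\<^sup>2"
    unfolding k by simp
  then show ?thesis
    using power2_le_imp_le[of 1 "cmod a"] by simp
qed

text \<open>Rounding the imaginary coordinate first and then the real part leaves a squared error of
  at most 11/16 + 1/4; the 11/16 comes from d = 11.\<close>

lemma Z_omega_round:
  assumes "d \<in> {1, 2, 3, 7, 11}"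
  shows "\<exists>b\<in>Z_omega d. cmod (z - b) \<le> sqrt (15/16)"
proof -
  have pos: "0 < Im (omega d)"
    using assms by (auto simp: Im_omega)
  have le: "(Im (omega d))\<^sup>2 \<le> 11/4"
    using assms by (auto simp: Im_omega power_divide)
  define n where "n = round (Im z / Im (omega d))"
  define m where "m = round (Re z - of_int n * Re (omega d))"
  define b where "b = of_int m + of_int n * omega d"
  have "\<bar>of_int n - Im z / Im (omega d)\<bar> \<le> 1/2"
    unfolding n_def by (rule of_int_round_abs_le)
  then have "\<bar>of_int n - Im z / Im (omega d)\<bar> * Im (omega d) \<le> 1/2 * Im (omega d)"
    using pos by (intro mult_right_mono) auto
  moreover have "\<bar>of_int n - Im z / Im (omega d)\<bar> * Im (omega d) = \<bar>Im (z - b)\<bar>"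
    using pos by (simp add: b_def abs_mult[symmetric] field_simps flip: abs_mult_pos)
  ultimately have "\<bar>Im (z - b)\<bar> \<le> \<bar>Im (omega d) / 2\<bar>"
    using pos by simp
  then have im: "(Im (z - b))\<^sup>2 \<le> (Im (omega d) / 2)\<^sup>2"
    by (simp only: abs_le_square_iff)
  have "\<bar>of_int m - (Re z - of_int n * Re (omega d))\<bar> \<le> 1/2"
    unfolding m_def by (rule of_int_round_abs_le)
  then have "\<bar>Re (z - b)\<bar> \<le> \<bar>1/2\<bar>"
    unfolding b_def by (simp add: algebra_simps abs_minus_commute)
  then have re: "(Re (z - b))\<^sup>2 \<le> (1/2)\<^sup>2"
    by (simp only: abs_le_square_iff)
  have "(cmod (z - b))\<^sup>2 \<le> 15/16"
    unfolding cmod_power2 using im re le by (simp add: power_divide)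
  then have "cmod (z - b) \<le> sqrt (15/16)"
    by (rule real_le_rsqrt)
  then show ?thesis
    unfolding b_def Z_omega_def by blast
qed

lemma euclidean_discrete_subring_Z_omega:
  assumes d: "d \<in> {1, 2, 3, 7, 11}"
  shows "euclidean_discrete_subring (Z_omega d) (sqrt (15/16))"
proof
  show "0 \<in> Z_omega d"
    unfolding Z_omega_def by (rule CollectI, rule exI[of _ 0], rule exI[of _ 0]) simp
  show "1 \<in> Z_omega d"
    unfolding Z_omega_def by (rule CollectI, rule exI[of _ 1], rule exI[of _ 0]) simp
next
  fix a b assume "a \<in> Z_omega d" "b \<in> Z_omega d"
  then obtain m n m' n' :: int
    where ab: "a = of_int m + of_int n * omega d" "b = of_int m' + of_int n' * omega d"
    by (auto simp: Z_omega_def)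
  have "a + b = of_int (m + m') + of_int (n + n') * omega d"
    by (simp add: ab algebra_simps)
  then show "a + b \<in> Z_omega d"
    unfolding Z_omega_def by blast
  obtain s t :: int where st: "omega d * omega d = of_int s + of_int t * omega d"
    using omega_square[OF d] by blast
  have "a * b = of_int (m * m') + of_int (m * n' + m' * n) * omega d
      + of_int (n * n') * (omega d * omega d)"
    by (simp add: ab algebra_simps)
  also have "\<dots> = of_int (m * m' + n * n' * s) + of_int (m * n' + m' * n + n * n' * t) * omega d"
    unfolding st by (simp add: algebra_simps)
  finally show "a * b \<in> Z_omega d"
    unfolding Z_omega_def by blast
next
  fix a assume "a \<in> Z_omega d"
  then obtain m n :: int where "a = of_int m + of_int n * omega d"
    by (auto simp: Z_omega_def)
  then have "- a = of_int (- m) + of_int (- n) * omega d"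
    by simp
  then show "- a \<in> Z_omega d"
    unfolding Z_omega_def by blast
qed (use d Z_omega_norm_ge_1 Z_omega_round in auto)

section \<open>The field of vertices\<close>

lemma Z_omega_subset_Q_sqrt: "Z_omega d \<subseteq> Q_sqrt d"
proof
  fix a assume "a \<in> Z_omega d"
  then obtain m n :: int where a: "a = of_int m + of_int n * omega d"
    by (auto simp: Z_omega_def)
  show "a \<in> Q_sqrt d"
  proof (cases "d \<in> {1, 2}")
    case True
    then have "a = of_rat (of_int m) + of_rat (of_int n) * csqrt (- of_nat d)"
      by (simp add: a omega_def del: csqrt_minus)
    then show ?thesis
      unfolding Q_sqrt_def by blast
  next
    case False
    then have "a = of_rat (of_int m + of_int n / 2) + of_rat (of_int n / 2) * csqrt (- of_nat d)"
      by (simp add: a omega_def of_rat_add of_rat_divide of_rat_mult field_simps del: csqrt_minus)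
    then show ?thesis
      unfolding Q_sqrt_def by blast
  qed
qed

lemma Q_sqrt_mult:
  assumes "a \<in> Q_sqrt d" "b \<in> Q_sqrt d"
  shows "a * b \<in> Q_sqrt d"
proof -
  obtain r s r' s' :: rat where ab: "a = of_rat r + of_rat s * csqrt (- of_nat d)"
    "b = of_rat r' + of_rat s' * csqrt (- of_nat d)"
    using assms by (auto simp: Q_sqrt_def)
  have sq: "csqrt (- of_nat d) * csqrt (- of_nat d) = of_rat (- of_nat d)"
    unfolding power2_eq_square[symmetric] power2_csqrt by (simp add: of_rat_minus)
  have "a * b = of_rat (r * r') + of_rat (r * s' + r' * s) * csqrt (- of_nat d)
      + of_rat (s * s') * (csqrt (- of_nat d) * csqrt (- of_nat d))"
    by (simp add: ab of_rat_add of_rat_mult algebra_simps del: csqrt_minus)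
  also have "\<dots> = of_rat (r * r' + s * s' * (- of_nat d))
      + of_rat (r * s' + r' * s) * csqrt (- of_nat d)"
    unfolding sq
    by (simp add: of_rat_add of_rat_mult of_rat_minus of_rat_diff algebra_simps del: csqrt_minus)
  finally show ?thesis
    unfolding Q_sqrt_def by blast
qed

lemma Q_sqrt_inverse:
  assumes "a \<in> Q_sqrt d"
  shows "inverse a \<in> Q_sqrt d"
proof -
  obtain r s :: rat where a: "a = of_rat r + of_rat s * csqrt (- of_nat d)"
    using assms by (auto simp: Q_sqrt_def)
  \<comment> \<open>The norm of \<open>a\<close>. For a = 0 the formula for the inverse still holds,
    both sides being 0.\<close>
  define N where "N = r * r + of_nat d * s * s"
  have of_rat: "(of_rat x :: complex) = of_real (of_rat x)" for x
    by (cases x) (simp add: of_rat_rat)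
  have conj: "cnj a = of_rat r + of_rat (- s) * csqrt (- of_nat d)"
    by (simp add: a csqrt_minus_of_nat of_rat of_rat_minus)
  have "(cmod a)\<^sup>2 = of_rat N"
    unfolding cmod_power2 a N_def csqrt_minus_of_nat of_rat
    by (simp add: of_rat_add of_rat_mult power2_eq_square)
  then have "inverse a = of_rat (1 / N) * cnj a"
    using complex_div_cnj[of 1 a] by (simp add: inverse_eq_divide of_rat_divide of_rat[of N])
  also have "\<dots> \<in> Q_sqrt d"
  proof (rule Q_sqrt_mult)
    have "of_rat (1 / N) = of_rat (1 / N) + of_rat 0 * csqrt (- of_nat d)"
      by simp
    then show "of_rat (1 / N) \<in> Q_sqrt d"
      unfolding Q_sqrt_def by blast
    show "cnj a \<in> Q_sqrt d"
      unfolding conj Q_sqrt_def by blast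
  qed
  finally show ?thesis .
qed

section \<open>The Farey graph\<close>

lemma ext_frac_vertex:
  assumes "p \<in> Z_omega d" "q \<in> Z_omega d"
  shows "ext_frac p q \<in> pverts (farey_graph d)"
  using assms Z_omega_subset_Q_sqrt[of d] Q_sqrt_mult[OF _ Q_sqrt_inverse, of p d q]
  by (auto simp: ext_frac_def farey_graph_def divide_inverse)

lemma parcs_farey_graph:
  assumes "discrete_subring (Z_omega d)"
  shows "(u, v) \<in> parcs (farey_graph d) \<longleftrightarrow> discrete_subring.adj (Z_omega d) u v"
proof -
  interpret discrete_subring "Z_omega d" by fact
  have image: "ext_moebius A None = ext_frac (A$1$1) (A$2$1)"
    "ext_moebius A (Some 0) = ext_frac (A$1$2) (A$2$2)" for A
    by (simp_all add: ext_moebius_def ext_frac_def moebius_def)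
  show ?thesis
  proof
    assume "(u, v) \<in> parcs (farey_graph d)"
    then obtain A where "A \<in> SL2 d" "u = ext_moebius A None" "v = ext_moebius A (Some 0)"
      by (auto simp: farey_graph_def PSL2_def)
    then show "adj u v"
      by (auto simp: image SL2_def det_2 intro!: adjI)
  next
    assume "adj u v"
    then obtain p q p' q' where *: "p \<in> Z_omega d" "q \<in> Z_omega d" "p' \<in> Z_omega d"
      "q' \<in> Z_omega d" "p * q' - p' * q = 1" "u = ext_frac p q" "v = ext_frac p' q'"
      by (elim adjE)
    define A :: "complex^2^2" where "A = vector [vector [p, p'], vector [q, q']]"
    have A: "A$1$1 = p" "A$1$2 = p'" "A$2$1 = q" "A$2$2 = q'"
      by (simp_all add: A_def)
    have "A \<in> SL2 d"
      using * by (simp add: SL2_def det_2 A forall_2)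
    moreover have "u = ext_moebius A None" "v = ext_moebius A (Some 0)"
      using * by (simp_all add: image A)
    ultimately show "(u, v) \<in> parcs (farey_graph d)"
      unfolding farey_graph_def PSL2_def by auto
  qed
qed

text \<open>Endpoints of edges are fractions of ring elements and so are vertices; checking the head
  covers one-vertex walks.\<close>

lemma vwalk_farey_graph:
  assumes "discrete_subring (Z_omega d)"
  shows "vwalk p (farey_graph d) \<longleftrightarrow>
    p \<noteq> [] \<and> hd p \<in> pverts (farey_graph d) \<and>
    successively (discrete_subring.adj (Z_omega d)) p"
proof -
  interpret discrete_subring "Z_omega d" by fact
  have arcs: "set (vwalk_arcs p) \<subseteq> parcs (farey_graph d) \<longleftrightarrow> successively adj p" for p
    by (induction p rule: vwalk_arcs.induct) (auto simp: parcs_farey_graph[OF assms])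
  have vertex: "v \<in> pverts (farey_graph d)" if "adj u v" for u v
    using that by (elim adjE) (simp add: ext_frac_vertex)
  have verts: "set p \<subseteq> pverts (farey_graph d)"
    if "successively adj p" "hd p \<in> pverts (farey_graph d)" for p
    using that
  proof (induction p)
    case (Cons u p)
    then show ?case
      using vertex[of u "hd p"] by (cases "p = []") (auto simp: successively_Cons)
  qed simp
  show ?thesis
    unfolding vwalk_def with_proj_simps arcs
    using verts[of p] by (metis hd_in_set subsetD)
qed

lemma geodesic_path_convergent_path:
  assumes d: "d \<in> {1, 2, 3, 7, 11}"
    and "set as \<subseteq> Z_omega d" "\<forall>a\<in>set as. 3 \<le> cmod a"
  shows "geodesic_path (farey_graph d) (convergent_path (0 # as))"
proof -
  interpret euclidean_discrete_subring "Z_omega d" "sqrt (15/16)"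
    using d by (rule euclidean_discrete_subring_Z_omega)
  note walk = vwalk_farey_graph[OF discrete_subring_axioms]
  have "None \<in> pverts (farey_graph d)"
    by (simp add: farey_graph_def)
  moreover have "successively adj (convergent_path (0 # as))"
    using assms(2) zero_mem by (intro successively_adj_convergent_path) simp
  moreover have "length as + 2 \<le> length q"
    if "vwalk q (farey_graph d)" "hd q = None" "last q = cf_value (0 # as)" for q
    using that walk_length_ge[OF assms(2,3)] by (simp add: walk del: cf_value.simps)
  ultimately show ?thesis
    unfolding geodesic_path_def by (force simp: walk simp del: cf_value.simps)
qed

theorem theorem6:
  fixes d :: nat and x :: "complex option" and as :: "complex list"
  assumes "d \<in> {1, 2, 3, 7, 11}"
    and "cf_expansion_of d (Finite_CF 0 as) x"
    and "\<forall>a \<in> set as. cmod a \<ge> 4.17209"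
  shows "geodesic_expansion_of d (Finite_CF 0 as) x \<and>
    (\<forall>c. geodesic_expansion_of d c x \<longrightarrow> c = Finite_CF 0 as)"
proof (intro conjI allI impI)
  interpret euclidean_discrete_subring "Z_omega d" "sqrt (15/16)"
    using assms(1) by (rule euclidean_discrete_subring_Z_omega)
  note walk = vwalk_farey_graph[OF discrete_subring_axioms]
  have as: "set as \<subseteq> Z_omega d" and x: "x = cf_value (0 # as)"
    using assms(2) by (auto simp: cf_expansion_of_def)
  have as3: "\<forall>a\<in>set as. 3 \<le> cmod a"
    using assms(3) by force
  have "geodesic_path (farey_graph d) (convergent_path (0 # take k as))" for k
    using as as3 set_take_subset[of k as]
    by (intro geodesic_path_convergent_path[OF assms(1)]) blast+
  then show "geodesic_expansion_of d (Finite_CF 0 as) x"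
    using assms(2) by (simp add: geodesic_expansion_of_def)
  fix c assume c: "geodesic_expansion_of d c x"
  show "c = Finite_CF 0 as"
  proof (cases c)
    case (Finite_CF b bs)
    let ?p = "convergent_path (b # bs)"
    have xb: "x = cf_value (b # bs)"
      and "\<forall>k\<le>length bs. geodesic_path (farey_graph d) (convergent_path (take (Suc k) (b # bs)))"
      using c by (simp_all add: Finite_CF geodesic_expansion_of_def cf_expansion_of_def)
    then have geo: "geodesic_path (farey_graph d) ?p"
      by (metis length_Cons order_refl take_all)
    have "vwalk (convergent_path (0 # as)) (farey_graph d)"
      using geodesic_path_convergent_path[OF assms(1) as as3] by (simp add: geodesic_path_def)
    \<comment> \<open>Both walks join infinity to x, so minimality of \<open>?p\<close> supplies the
      length bound for uniqueness of short walks.\<close>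
    then have "vwalk_length ?p \<le> vwalk_length (convergent_path (0 # as))"
      using geo x xb unfolding geodesic_path_def
      by (metis hd_convergent_path last_convergent_path)
    then have "?p = convergent_path (0 # as)"
      using geo x xb by (intro short_walk_eq_convergent_path[OF as as3])
        (simp_all add: geodesic_path_def walk del: cf_value.simps)
    then have "b # bs = 0 # as"
      by (rule inj_convergent_path)
    then show ?thesis
      by (simp add: Finite_CF)
  next
    case (Infinite_CF b)
    \<comment> \<open>Here \<open>w 0\<close> is infinity and \<open>w (Suc k)\<close> is the k-th
      convergent, which accounts for the shifts of index below.\<close>
    define w where "w k = cf_value (map b [0..<k])" for k
    have lim: "limitin (Alexandroff_compactification euclidean) (\<lambda>k. w (Suc k)) x sequentially"
      and b: "range b \<subseteq> Z_omega d"
      and geo: "\<And>k. geodesic_path (farey_graph d) (convergent_path (map b [0..<Suc k]))"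
      using c by (simp_all add: Infinite_CF geodesic_expansion_of_def cf_expansion_of_def w_def
          del: upt_Suc)
    have path: "convergent_path (map b [0..<k]) = map w [0..<Suc k]" for k
      by (auto simp: convergent_path_def w_def take_map simp del: upt_Suc)
    have "geodesic_ray w"
      unfolding geodesic_ray_def
    proof (intro conjI allI impI)
      fix k
      have "successively adj (map w [0..<Suc (Suc k)])"
        using geo[of k] by (simp only: geodesic_path_def walk path)
      then show "adj (w k) (w (Suc k))"
        by (simp add: successively_append_iff)
    next
      fix k p
      assume p: "p \<noteq> [] \<and> successively adj p \<and> hd p = w 0 \<and> last p = w k"
      show "k < length p"
      proof (cases k)
        case 0
        then show ?thesis
          using p by simp
      next
        case (Suc j)
        have "w 0 = None"
          by (simp add: w_def)
        moreover have "None \<in> pverts (farey_graph d)"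
          by (simp add: farey_graph_def)
        ultimately have "vwalk p (farey_graph d)"
          using p by (simp add: walk)
        moreover have "hd p = hd (convergent_path (map b [0..<k]))"
          "last p = last (convergent_path (map b [0..<k]))"
          using p \<open>w 0 = None\<close> by (simp_all add: w_def)
        ultimately have "vwalk_length (convergent_path (map b [0..<k])) \<le> vwalk_length p"
          using geo[of j] unfolding geodesic_path_def Suc by blast
        then show ?thesis
          using p by (cases p) auto
      qed
    qed
    obtain \<xi> where \<xi>: "cf_value (0 # as) = Some \<xi>"
      using potential_cf_value_bounded[OF as3] by blast
    \<comment> \<open>In the one-point compactification, open sets of the plane remain
      neighbourhoods of their finite points. Taking the whole plane gives eventual
      finiteness.\<close>
    have near: "\<forall>\<^sub>F k in sequentially. w k \<in> Some ` U" if "open U" "\<xi> \<in> U" for U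
    proof -
      have "\<forall>\<^sub>F k in sequentially. w (Suc k) \<in> Some ` U"
        using lim that unfolding limitin_def x \<xi> by simp
      then show ?thesis
        by (rule eventually_sequentially_Suc[THEN iffD1])
    qed
    have "\<forall>\<^sub>F k in sequentially. w k \<noteq> None"
      using near[of UNIV] by (auto elim: eventually_mono)
    moreover have "(\<lambda>k. the (w k)) \<longlonglongrightarrow> \<xi>"
    proof (rule topological_tendstoI)
      fix U assume "open U" "\<xi> \<in> U"
      then show "\<forall>\<^sub>F k in sequentially. the (w k) \<in> U"
        using near[of U] by (auto elim: eventually_mono)
    qed
    ultimately show ?thesis
      using geodesic_ray_not_tendsto_convergent[OF as as3 \<open>geodesic_ray w\<close> \<xi>] by blast
  qed
qed

end
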